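(* Let $n\ge 1$ be an integer and let $C_n$ be the digital cycle of $n$ points. Then \[ F(C_n) = \begin{cases} \{1\} &\text{ if } n=1, \\ \{0,\dots,n\} &\text{ if } 1<n\le 4, \\ \{0,1,\dots,\lfloor n/2 \rfloor + 1, n\} &\text{ if } n>4.\end{cases} \]
   Context: A digital image is a pair $(X,\kappa)$, where $X\subset\mathbb{Z}^m$ for some $m$ and $\kappa$ is an adjacency (a symmetric, irreflexive relation) on $X$; thus it is a simple graph with vertex set $X$. Write $x\leftrightarrow y$ if $x,y$ are adjacent. A function $f:X\to Y$ between digital images is continuous if $x\leftrightarrow y$ in $X$ implies that $f(x),f(y)$ are adjacent or equal in $Y$. $\mathrm{Fix}(f)=\{x\in X\mid f(x)=x\}$, and $\#$ denotes the number of elements of a set. The fixed point spectrum of $X$ is $F(X)=\{\#\mathrm{Fix}(f)\mid f:X\to X\text{ is continuous}\}$. The digital $n$-cycle $C_n=\{x_0,\dots,x_{n-1}\}$ is the image with $n$ points in which each $x_i$ is adjacent only to $x_{i+1}$ and $x_{i-1}$, subscripts being read modulo $n$ ($C_1$ is a single point). *)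

theory Defs
  imports "HOL-Analysis.Finite_Cartesian_Product"
begin

definition digital_image :: "(int ^ 'm) set \<Rightarrow> (int ^ 'm) rel \<Rightarrow> bool" where
  "digital_image X \<kappa> \<longleftrightarrow> \<kappa> \<subseteq> X \<times> X \<and> sym \<kappa> \<and> irrefl \<kappa>"

(* A map X \<Rightarrow> Y is a total function on the ambient lattice sending X into Y;
   only its values on X matter here and in Fix. *)
definition digitally_continuous ::
  "(int ^ 'm) set \<Rightarrow> (int ^ 'm) rel \<Rightarrow> (int ^ 'k) set \<Rightarrow> (int ^ 'k) rel
     \<Rightarrow> (int ^ 'm \<Rightarrow> int ^ 'k) \<Rightarrow> bool" where
  "digitally_continuous X \<kappa> Y \<mu> f \<longleftrightarrow>
     f ` X \<subseteq> Y \<and> (\<forall>x\<in>X. \<forall>y\<in>X. (x, y) \<in> \<kappa> \<longrightarrow> (f x, f y) \<in> \<mu> \<or> f x = f y)"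

definition Fix :: "(int ^ 'm) set \<Rightarrow> (int ^ 'm \<Rightarrow> int ^ 'm) \<Rightarrow> (int ^ 'm) set" where
  "Fix X f = {x \<in> X. f x = x}"

(* Intended for finite X only: card sends infinite sets to 0. *)
definition fixed_point_spectrum :: "(int ^ 'm) set \<Rightarrow> (int ^ 'm) rel \<Rightarrow> nat set" where
  "fixed_point_spectrum X \<kappa> = {card (Fix X f) | f. digitally_continuous X \<kappa> X \<kappa> f}"

(* The i-th and j-th points are adjacent iff one index is the successor of the other modulo n.
   The conjunct i \<noteq> j matters only for n = 1, where i is its own successor modulo n. *)
definition digital_cycle :: "nat \<Rightarrow> (int ^ 'm) set \<Rightarrow> (int ^ 'm) rel \<Rightarrow> bool" where
  "digital_cycle n X \<kappa> \<longleftrightarrow>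
     digital_image X \<kappa> \<and>
     (\<exists>x :: nat \<Rightarrow> int ^ 'm. inj_on x {..<n} \<and> X = x ` {..<n} \<and>
        (\<forall>i<n. \<forall>j<n. (x i, x j) \<in> \<kappa> \<longleftrightarrow>
           i \<noteq> j \<and> (j = (i + 1) mod n \<or> i = (j + 1) mod n)))"

lemma digital_cycle_exists:
  "\<exists>(X :: (int ^ 'm) set) \<kappa>. digital_cycle n X \<kappa>"
proof -
  define x :: "nat \<Rightarrow> int ^ 'm" where "x = (\<lambda>i. \<chi> _. int i)"
  define \<kappa> where "\<kappa> = {(x i, x j) | i j. i < n \<and> j < n \<and>
      i \<noteq> j \<and> (j = (i + 1) mod n \<or> i = (j + 1) mod n)}"
  have inj: "x i = x j \<longleftrightarrow> i = j" for i j
    by (simp add: x_def vec_eq_iff)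
  have "digital_image (x ` {..<n}) \<kappa>"
    unfolding digital_image_def sym_def irrefl_def \<kappa>_def by (auto simp: inj)
  moreover have "\<forall>i<n. \<forall>j<n. (x i, x j) \<in> \<kappa> \<longleftrightarrow>
      i \<noteq> j \<and> (j = (i + 1) mod n \<or> i = (j + 1) mod n)"
    unfolding \<kappa>_def by (auto simp: inj)
  moreover have "inj_on x {..<n}"
    by (simp add: inj_on_def inj)
  ultimately show ?thesis
    unfolding digital_cycle_def by blast
qed

end

theory Submission
  imports Defs
begin

text \<open>Label the cycle by the integers modulo \<open>n\<close>. If \<open>f\<close> has a fixed point but is not the identity,
let \<open>d\<close> be the length of an arc whose endpoints are fixed and whose interior contains a non-fixed
point but no fixed point. Along an arc the displacement of \<open>f\<close> changes by \<open>0\<close>, \<open>-1\<close> or \<open>-2\<close> per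
step modulo \<open>n\<close>, so for \<open>2 d < n\<close> it could only vanish at both ends by vanishing throughout. Hence
\<open>2 d \<ge> n\<close>, and at most \<open>n - d + 1 \<le> n div 2 + 1\<close> points are fixed. Conversely, folding the cycle
onto an arc with \<open>k \<le> n div 2 + 1\<close> points fixes exactly that arc, and a rotation fixes nothing.\<close>

text \<open>A self-map of the cycle is represented by its effect on integer labels. Both clauses are
  congruences, so a representative of each value may be chosen freely; the second clause makes the
  map descend to residues.\<close>

definition cyclic_map :: "nat \<Rightarrow> (int \<Rightarrow> int) \<Rightarrow> bool" where
  "cyclic_map n g \<longleftrightarrow>
    (\<forall>i. \<exists>c\<in>{-1, 0, 1}. int n dvd g (i + 1) - g i - c) \<and>
    (\<forall>i j. int n dvd i - j \<longrightarrow> int n dvd g i - g j)"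

definition fixed_residues :: "nat \<Rightarrow> (int \<Rightarrow> int) \<Rightarrow> int set" where
  "fixed_residues n g = {i \<in> {0..<int n}. int n dvd g i - i}"

section \<open>Upper bound: displacement along arcs between fixed points\<close>

lemma arc_between_fixed_points:
  assumes "cyclic_map n g"
    and start: "int n dvd g a - a"
    and finish: "int n dvd g (a + int d) - (a + int d)"
    and short: "2 * d < n" and "j \<le> d"
  shows "int n dvd g (a + int j) - (a + int j)"
proof -
  have step: "\<exists>c\<in>{-1, 0, 1}. int n dvd g (i + 1) - g i - c" for i
    using assms(1) by (simp add: cyclic_map_def)
  \<comment> \<open>Passing from the step \<open>c\<close> to the loss \<open>e = 1 - c\<close>
    makes all increments nonnegative, so that their partial sums are monotone.\<close>
  have "\<exists>e\<in>{0..2::int}. int n dvd g (i + 1) - g i - 1 + e" for i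
  proof -
    obtain c where "c \<in> {-1, 0, 1}" "int n dvd g (i + 1) - g i - c"
      using step by blast
    then show ?thesis
      by (intro bexI[of _ "1 - c"]) (auto simp: algebra_simps)
  qed
  then obtain e where e: "e i \<in> {0..2::int}" "int n dvd g (i + 1) - g i - 1 + e i" for i
    by metis
  \<comment> \<open>\<open>m k\<close> is an actual integer congruent to minus the displacement at
    offset \<open>k\<close>, which itself is controlled only modulo \<open>n\<close>.\<close>
  define m where "m = (\<lambda>k. \<Sum>l<k. e (a + int l))"
  have drift: "int n dvd g (a + int k) - (a + int k) + m k" for k
  proof (induction k)
    case 0
    then show ?case using start by (simp add: m_def)
  next
    case (Suc k)
    have "int n dvd (g (a + int k) - (a + int k) + m k)
        + (g (a + int k + 1) - g (a + int k) - 1 + e (a + int k))"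
      by (rule dvd_add[OF Suc e(2)])
    then show ?case by (simp add: m_def algebra_simps)
  qed
  have "int n dvd m d"
    using drift[of d] finish by (simp add: dvd_add_right_iff)
  moreover have "m d \<le> int d * 2"
    unfolding m_def using sum_bounded_above[of "{..<d}" "\<lambda>l. e (a + int l)" 2] e(1) by simp
  moreover have "m d \<ge> 0"
    unfolding m_def using e(1) by (intro sum_nonneg) simp
  \<comment> \<open>A multiple of \<open>n\<close> in the range from 0 to \<open>2 * d < n\<close>
    must vanish; monotonicity then forces every earlier partial sum to vanish.\<close>
  ultimately have "m d = 0"
    using short zdvd_imp_le[of "int n" "m d"] by linarith
  moreover have "m j \<le> m d" "m j \<ge> 0"
    unfolding m_def using e(1) \<open>j \<le> d\<close> by (auto intro!: sum_mono2 sum_nonneg)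
  ultimately have "m j = 0" by linarith
  then show ?thesis using drift[of j] by simp
qed

text \<open>This allows the cycle to be cut at any chosen point before counting. Reduction modulo
  \<open>n\<close> is a bijection between the two windows.\<close>

lemma card_periodic_window:
  assumes "n > 0" and periodic: "\<And>i j. i mod int n = j mod int n \<Longrightarrow> P i \<longleftrightarrow> P j"
  shows "card {i \<in> {p..<p + int n}. P i} = card {i \<in> {0..<int n}. P i}"
proof (rule bij_betw_same_card[where f = "\<lambda>i. i mod int n"],
    rule bij_betw_byWitness[where f' = "\<lambda>j. p + (j - p) mod int n"])
  have "p + (i - p) mod int n = i" if "i \<in> {p..<p + int n}" for i
    using that by simp
  then show "\<forall>i\<in>{i \<in> {p..<p + int n}. P i}. p + (i mod int n - p) mod int n = i"
    by (simp add: mod_diff_left_eq)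
  show "\<forall>j\<in>{i \<in> {0..<int n}. P i}. (p + (j - p) mod int n) mod int n = j"
    by (simp add: mod_simps)
  have "P (i mod int n) = P i" for i
    by (rule periodic) simp
  then show "(\<lambda>i. i mod int n) ` {i \<in> {p..<p + int n}. P i} \<subseteq> {i \<in> {0..<int n}. P i}"
    using assms(1) by auto
  have "P (p + (j - p) mod int n) = P j" for j
    by (rule periodic) (simp add: mod_simps)
  then show "(\<lambda>j. p + (j - p) mod int n) ` {i \<in> {0..<int n}. P i} \<subseteq> {i \<in> {p..<p + int n}. P i}"
    using assms(1) by auto
qed

lemma card_fixed_residues_le:
  assumes "n > 0" and g: "cyclic_map n g" and nonfixed: "\<not> int n dvd g p - p"
  shows "card (fixed_residues n g) \<le> n div 2 + 1"
proof -
  have periodic: "int n dvd g i - i \<longleftrightarrow> int n dvd g j - j" if "i mod int n = j mod int n" for i j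
  proof -
    have "int n dvd i - j" using that by (simp add: mod_eq_dvd_iff)
    then have "int n dvd (g i - g j) - (i - j)"
      using g by (auto simp: cyclic_map_def intro: dvd_diff)
    moreover have "g i - i = (g i - g j) - (i - j) + (g j - j)" by simp
    ultimately show ?thesis by (metis dvd_add_right_iff)
  qed
  \<comment> \<open>Starting the window at the non-fixed \<open>p\<close> places \<open>p\<close>
    strictly between the last fixed point of the previous window and the first one of this
    window.\<close>
  define S where "S = {i \<in> {p..<p + int n}. int n dvd g i - i}"
  have card_S: "card (fixed_residues n g) = card S"
    unfolding fixed_residues_def S_def
    by (rule card_periodic_window[OF assms(1) periodic, symmetric])
  show ?thesis
  proof (cases "S = {}")
    case True
    then show ?thesis by (simp add: card_S)
  next
    case False
    have "finite S" unfolding S_def by (rule finite_Collect_conjI) simp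
    define a b where "a = Max S" and "b = Min S"
    have ab: "a \<in> S" "b \<in> S" "S \<subseteq> {b..a}"
      using \<open>finite S\<close> False by (auto simp: a_def b_def)
    have "p < b" using ab(2) nonfixed by (cases "p = b") (auto simp: S_def)
    have "a < p + int n" "b \<le> a" using ab by (auto simp: S_def)
    \<comment> \<open>The arc runs from \<open>a - int n\<close>, the fixed point \<open>a\<close>
      moved back one turn, to \<open>b\<close>. It contains \<open>p\<close>.\<close>
    define d where "d = nat (b - (a - int n))"
    have d: "int d = b - (a - int n)"
      using \<open>p < b\<close> \<open>a < p + int n\<close> by (simp add: d_def)
    have start: "int n dvd g (a - int n) - (a - int n)"
      using ab(1) periodic[of "a - int n" a] by (simp add: S_def)
    have finish: "int n dvd g (a - int n + int d) - (a - int n + int d)"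
      using ab(2) by (simp add: S_def d)
    have "n \<le> 2 * d"
    proof (rule ccontr)
      assume "\<not> n \<le> 2 * d"
      \<comment> \<open>The second number is the offset of \<open>p\<close> in this arc; a short arc
        would make \<open>p\<close> fixed.\<close>
      then have "2 * d < n" "nat (p - (a - int n)) \<le> d"
        using \<open>p < b\<close> \<open>a < p + int n\<close> d by linarith+
      from arc_between_fixed_points[OF g start finish this]
      show False
        using nonfixed \<open>a < p + int n\<close> by simp
    qed
    \<comment> \<open>Here \<open>a - b + 1 = n - d + 1\<close>, and \<open>n \<le> 2 * d\<close>
      turns this into the bound \<open>n div 2 + 1\<close>.\<close>
    moreover have "card S \<le> nat (a - b + 1)"
      using card_mono[OF _ ab(3)] by simp
    ultimately show ?thesis
      using d \<open>b \<le> a\<close> unfolding card_S by linarith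
  qed
qed

section \<open>Realising the cardinalities\<close>

lemma fixed_residues_fold:
  assumes "2 * m \<le> n" "n > 1"
  shows "\<exists>g. cyclic_map n g \<and> card (fixed_residues n g) = m + 1"
proof (intro exI conjI)
  \<comment> \<open>The tent map rises as the identity on \<open>0..m\<close>, descends to 0 at
    \<open>2 * m\<close> and stays there.\<close>
  let ?F = "\<lambda>i. max 0 (int m - \<bar>i - int m\<bar>)"
  let ?g = "\<lambda>i. ?F (i mod int n)"
  have "\<exists>c\<in>{-1, 0, 1}. int n dvd ?g (i + 1) - ?g i - c" for i
  proof (rule bexI[of _ "?g (i + 1) - ?g i"])
    have bounds: "0 \<le> i mod int n" "i mod int n < int n" using assms by simp_all
    have "(i + 1) mod int n = (i mod int n + 1) mod int n" by (simp add: mod_simps)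
    also have "\<dots> = (if i mod int n + 1 = int n then 0 else i mod int n + 1)"
      using bounds by auto
    finally have next_i: "(i + 1) mod int n = \<dots>" .
    show "?g (i + 1) - ?g i \<in> {-1, 0, 1}"
    proof (cases "i mod int n + 1 = int n")
      case True
      \<comment> \<open>At the seam the next value is 0. Since \<open>2 * m \<le> n\<close>, the
        tent has already come down to 0 or 1 at \<open>n - 1\<close>.\<close>
      then have "i mod int n = int n - 1" by simp
      then show ?thesis unfolding next_i using assms by auto
    next
      case False
      then show ?thesis unfolding next_i using bounds by auto
    qed
  qed simp
  then show "cyclic_map n ?g"
    by (simp add: cyclic_map_def flip: mod_eq_dvd_iff)
  have "int n dvd ?g i - i \<longleftrightarrow> i \<le> int m" if "0 \<le> i" "i < int n" for i
  proof -
    have "\<bar>?F i - i\<bar> < int n" using that assms by auto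
    then have "int n dvd ?F i - i \<longleftrightarrow> ?F i = i"
      using dvd_imp_le_int[of "?F i - i" "int n"] by auto
    also have "\<dots> \<longleftrightarrow> i \<le> int m" using that by auto
    finally show ?thesis using that by simp
  qed
  then have "fixed_residues n ?g = {0..int m}"
    using assms unfolding fixed_residues_def by auto
  then show "card (fixed_residues n ?g) = m + 1" by (simp add: nat_add_distrib)
qed

lemma cyclic_map_id: "cyclic_map n id"
  by (simp add: cyclic_map_def)

lemma card_fixed_residues_all:
  assumes "\<And>i. int n dvd g i - i"
  shows "card (fixed_residues n g) = n"
proof -
  have "fixed_residues n g = {0..<int n}" using assms by (auto simp: fixed_residues_def)
  then show ?thesis by simp
qed

lemma fixed_residues_cards:
  assumes "n > 1"
  shows "{card (fixed_residues n g) | g. cyclic_map n g} = {0..n div 2 + 1} \<union> {n}"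
    (is "?L = ?R")
proof
  show "?L \<subseteq> ?R"
  proof
    fix k assume "k \<in> ?L"
    then obtain g where g: "cyclic_map n g" "k = card (fixed_residues n g)" by blast
    show "k \<in> ?R"
    proof (cases "\<exists>p. \<not> int n dvd g p - p")
      case True
      then show ?thesis using card_fixed_residues_le[of n g] g assms by auto
    next
      case False
      then show ?thesis using g card_fixed_residues_all[of n g] by simp
    qed
  qed
  show "?R \<subseteq> ?L"
  proof
    fix k assume k: "k \<in> ?R"
    have "\<exists>g. cyclic_map n g \<and> card (fixed_residues n g) = k"
    proof (cases k)
      case 0
      \<comment> \<open>The rotation by one step has constant displacement 1, which is not divisible
        by \<open>n > 1\<close>.\<close>
      have "cyclic_map n (\<lambda>i. i + 1)" by (simp add: cyclic_map_def)
      moreover have "fixed_residues n (\<lambda>i. i + 1) = {}"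
        using assms by (simp add: fixed_residues_def)
      ultimately show ?thesis using 0 by (metis card.empty)
    next
      case (Suc m)
      then consider "k = n" | "2 * m \<le> n" using k by fastforce
      then show ?thesis
      proof cases
        case 1
        then show ?thesis using cyclic_map_id[of n] card_fixed_residues_all[of n id] by auto
      next
        case 2
        then show ?thesis using fixed_residues_fold[OF _ assms, of m] Suc by simp
      qed
    qed
    then show "k \<in> ?L" by blast
  qed
qed

section \<open>Transfer from digital cycles to integer labels\<close>

lemma digital_cycle_labelling:
  fixes X :: "(int ^ 'm) set"
  assumes "n > 0" and "digital_cycle n X \<kappa>"
  obtains z :: "int \<Rightarrow> int ^ 'm" where "X = range z" and "\<And>i j. z i = z j \<longleftrightarrow> int n dvd i - j"
    and "\<And>i j. (z i, z j) \<in> \<kappa> \<or> z i = z j \<longleftrightarrow> (\<exists>c\<in>{-1, 0, 1}. int n dvd j - i - c)"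
proof -
  from assms(2) obtain x where inj: "inj_on x {..<n}" and X: "X = x ` {..<n}"
    and adj: "\<And>i j. i < n \<Longrightarrow> j < n \<Longrightarrow> (x i, x j) \<in> \<kappa> \<longleftrightarrow>
      i \<noteq> j \<and> (j = (i + 1) mod n \<or> i = (j + 1) mod n)"
    unfolding digital_cycle_def by blast
  \<comment> \<open>Extending the labelling periodically to all integers replaces the wrap-around in
    the definition of the cycle by congruences.\<close>
  define r where "r i = nat (i mod int n)" for i
  define z where "z i = x (r i)" for i
  have r_lt: "r i < n" for i using assms(1) by (simp add: r_def nat_less_iff)
  have r_eq: "r i = r j \<longleftrightarrow> int n dvd i - j" for i j
    using assms(1) by (simp add: r_def eq_nat_nat_iff mod_eq_dvd_iff)
  have z_eq: "z i = z j \<longleftrightarrow> int n dvd i - j" for i j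
    using inj r_lt unfolding z_def inj_on_def r_eq[symmetric] by auto
  have r_Suc: "r (i + 1) = (r i + 1) mod n" for i
  proof -
    have "int (r (i + 1)) = int ((r i + 1) mod n)"
      using assms(1) by (simp add: r_def zmod_int mod_simps add.commute)
    then show ?thesis by (simp only: of_nat_eq_iff)
  qed
  have adj_z: "(z i, z j) \<in> \<kappa> \<longleftrightarrow> z i \<noteq> z j \<and> (int n dvd j - (i + 1) \<or> int n dvd i - (j + 1))" for i j
    unfolding z_def[of i] z_def[of j] adj[OF r_lt r_lt] r_Suc[symmetric] r_eq
    unfolding z_def[symmetric] z_eq ..
  have "range r = {..<n}"
  proof
    show "{..<n} \<subseteq> range r"
    proof
      fix i assume "i \<in> {..<n}"
      then have "r (int i) = i" by (simp add: r_def)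
      then show "i \<in> range r" by (metis rangeI)
    qed
  qed (use r_lt in auto)
  then have "X = range z"
    by (metis X image_image z_def image_cong)
  \<comment> \<open>Continuous maps preserve the relation "adjacent or equal". It has this one
    description for every \<open>n > 0\<close>, even for \<open>n \<le> 2\<close>, where some of the
    steps -1, 0, 1 coincide modulo \<open>n\<close>.\<close>
  moreover have "(z i, z j) \<in> \<kappa> \<or> z i = z j \<longleftrightarrow> (\<exists>c\<in>{-1, 0, 1}. int n dvd j - i - c)" for i j
  proof -
    have "int n dvd i - (j + 1) \<longleftrightarrow> int n dvd j - i - (-1)"
      by (subst dvd_diff_commute) (simp add: algebra_simps)
    moreover have "z i = z j \<longleftrightarrow> int n dvd j - i - 0"
      unfolding z_eq by (subst dvd_diff_commute) simp
    moreover have "int n dvd j - (i + 1) \<longleftrightarrow> int n dvd j - i - 1"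
      by (simp add: algebra_simps)
    ultimately show ?thesis unfolding adj_z by (simp only: bex_simps) blast
  qed
  ultimately show ?thesis using z_eq by (intro that) auto
qed

lemma digital_cycle_spectrum:
  fixes X :: "(int ^ 'm) set"
  assumes "n > 0" and "digital_cycle n X \<kappa>"
  shows "fixed_point_spectrum X \<kappa> = {card (fixed_residues n g) | g. cyclic_map n g}"
proof -
  obtain z :: "int \<Rightarrow> int ^ 'm" where X: "X = range z"
    and z_eq: "\<And>i j. z i = z j \<longleftrightarrow> int n dvd i - j"
    and near: "\<And>i j. (z i, z j) \<in> \<kappa> \<or> z i = z j \<longleftrightarrow> (\<exists>c\<in>{-1, 0, 1}. int n dvd j - i - c)"
    by (rule digital_cycle_labelling[OF assms]) (rule that)
  have near_sym: "(z i, z j) \<in> \<kappa> \<or> z i = z j" if "(z j, z i) \<in> \<kappa> \<or> z j = z i" for i j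
  proof -
    have "sym \<kappa>" using assms(2) by (simp add: digital_cycle_def digital_image_def)
    then show ?thesis using that symD[OF \<open>sym \<kappa>\<close>, of "z j" "z i"] by fastforce
  qed
  have continuous: "digitally_continuous X \<kappa> X \<kappa> f \<longleftrightarrow> cyclic_map n g"
    if fg: "\<And>i. f (z i) = z (g i)" for f g
  proof
    assume cont: "digitally_continuous X \<kappa> X \<kappa> f"
    have "(z (g i), z (g (i + 1))) \<in> \<kappa> \<or> z (g i) = z (g (i + 1))" for i
    proof -
      have "(z i, z (i + 1)) \<in> \<kappa> \<or> z i = z (i + 1)" unfolding near by simp
      then show ?thesis
        using cont unfolding X digitally_continuous_def fg[symmetric] by (metis rangeI)
    qed
    moreover have "int n dvd g i - g j" if "int n dvd i - j" for i j
      using that by (simp flip: z_eq fg)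
    ultimately show "cyclic_map n g"
      unfolding near by (simp add: cyclic_map_def)
  next
    assume g: "cyclic_map n g"
    \<comment> \<open>Consecutive labels suffice for continuity: adjacent points have labels
      differing by -1, 0 or 1 modulo \<open>n\<close>, and the backward step is covered by
      symmetry.\<close>
    have step: "(z (g i), z (g (i + 1))) \<in> \<kappa> \<or> z (g i) = z (g (i + 1))" for i
      using g unfolding near by (simp add: cyclic_map_def)
    have "(f (z i), f (z j)) \<in> \<kappa> \<or> f (z i) = f (z j)" if adj: "(z i, z j) \<in> \<kappa>" for i j
    proof -
      obtain c where "c \<in> {-1, 0, 1}" and c: "int n dvd j - i - c"
        using near[THEN iffD1, OF disjI1[OF adj]] by (rule bexE)
      then consider "c = 0" | "c = 1" | "c = -1" by blast
      then show ?thesis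
      proof cases
        case 1
        then have "z j = z i" using c by (simp add: z_eq)
        then show ?thesis by simp
      next
        case 2
        then have "z j = z (i + 1)" using c by (simp add: z_eq algebra_simps)
        then have "f (z j) = z (g (i + 1))" by (simp only: fg)
        then show ?thesis using step[of i] by (simp only: fg)
      next
        case 3
        then have "z (j + 1) = z i" using c by (simp add: z_eq algebra_simps)
        then have "f (z i) = z (g (j + 1))" by (simp only: fg flip: \<open>z (j + 1) = z i\<close>)
        then show ?thesis using near_sym[OF step[of j]] by (simp only: fg)
      qed
    qed
    moreover have "f ` X \<subseteq> X" unfolding X by (auto simp: fg)
    ultimately show "digitally_continuous X \<kappa> X \<kappa> f"
      unfolding digitally_continuous_def X by blast
  qed
  have card_Fix: "card (Fix X f) = card (fixed_residues n g)"
    if fg: "\<And>i. f (z i) = z (g i)" for f g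
  proof -
    have "inj_on z {0..<int n}"
      by (auto simp: inj_on_def z_eq simp flip: mod_eq_dvd_iff)
    then have "inj_on z (fixed_residues n g)"
      by (rule inj_on_subset) (auto simp: fixed_residues_def)
    moreover have "Fix X f = z ` fixed_residues n g"
    proof -
      have "z i = z (i mod int n)" "i mod int n \<in> {0..<int n}" for i
        using assms(1) by (simp_all add: z_eq flip: mod_eq_dvd_iff)
      then have "X = z ` {0..<int n}" unfolding X by blast
      then show ?thesis
        unfolding Fix_def fixed_residues_def by (auto simp: fg z_eq)
    qed
    ultimately show ?thesis by (simp add: card_image)
  qed
  show ?thesis
  proof (intro equalityI subsetI)
    fix k assume "k \<in> fixed_point_spectrum X \<kappa>"
    then obtain f where f: "digitally_continuous X \<kappa> X \<kappa> f" "k = card (Fix X f)"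
      unfolding fixed_point_spectrum_def by blast
    have "f ` X \<subseteq> X" using f(1) by (simp add: digitally_continuous_def)
    \<comment> \<open>The labels of the images are chosen independently for each \<open>i\<close>;
      their compatibility follows from \<open>fg\<close> and \<open>z_eq\<close>.\<close>
    then have "\<exists>j. f (z i) = z j" for i unfolding X by blast
    then obtain g where fg: "f (z i) = z (g i)" for i by metis
    then show "k \<in> {card (fixed_residues n g) | g. cyclic_map n g}"
      using f continuous[of f g, OF fg] card_Fix[of f g, OF fg] by auto
  next
    fix k assume "k \<in> {card (fixed_residues n g) | g. cyclic_map n g}"
    then obtain g where g: "cyclic_map n g" "k = card (fixed_residues n g)" by blast
    \<comment> \<open>\<open>inv z\<close> picks some label of a point of \<open>X\<close>; the
      second clause of \<open>cyclic_map\<close> makes the choice immaterial. Values outside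
      \<open>X\<close> do not affect continuity or \<open>Fix\<close>.\<close>
    define f where "f v = z (g (inv z v))" for v
    have fg: "f (z i) = z (g i)" for i
    proof -
      have "int n dvd inv z (z i) - i" by (simp add: f_inv_into_f flip: z_eq)
      then show ?thesis using g(1) by (simp add: f_def z_eq cyclic_map_def)
    qed
    have "digitally_continuous X \<kappa> X \<kappa> f" "k = card (Fix X f)"
      using g continuous[of f g, OF fg] card_Fix[of f g, OF fg] by simp_all
    then show "k \<in> fixed_point_spectrum X \<kappa>"
      unfolding fixed_point_spectrum_def by blast
  qed
qed

theorem corollary9p6:
  fixes n :: nat and X :: "(int ^ 'm) set" and \<kappa> :: "(int ^ 'm) rel"
  assumes "n \<ge> 1"
    and "digital_cycle n X \<kappa>"
  shows "fixed_point_spectrum X \<kappa> =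
    (if n = 1 then {1}
     else if n \<le> 4 then {0..n}
     else {0..n div 2 + 1} \<union> {n})"
proof (cases "n = 1")
  case True
  \<comment> \<open>Modulo 1 there is a single residue and every map fixes it; the identity then
    shows that the spectrum is nonempty.\<close>
  have "card (fixed_residues n g) = 1" for g
  proof -
    have "fixed_residues n g = {0}" by (auto simp: fixed_residues_def True)
    then show ?thesis by simp
  qed
  then show ?thesis
    using digital_cycle_spectrum[OF _ assms(2)] cyclic_map_id[of n] True by auto
next
  case False
  then have "n > 1" using assms(1) by simp
  then have "fixed_point_spectrum X \<kappa> = {0..n div 2 + 1} \<union> {n}"
    using digital_cycle_spectrum[OF _ assms(2)] fixed_residues_cards by simp
  moreover have "{0..n div 2 + 1} \<union> {n} = {0..n}" if "n \<le> 4"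
  proof -
    \<comment> \<open>For \<open>n\<close> from 2 to 4 the value \<open>n\<close> exceeds
      \<open>n div 2 + 1\<close> by at most one, so no gap is left. The first gap occurs at
      \<open>n = 5\<close>.\<close>
    have "n \<le> (n div 2 + 1) + 1" "n div 2 + 1 \<le> n"
      using that \<open>n > 1\<close> by linarith+
    then show ?thesis by auto
  qed
  ultimately show ?thesis using False by simp
qed

end
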